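(* Fix a mode theory $\mathcal{M}$ (a strict 2-category) and consider the multimodal natural deduction system described in the context. The following cut rule is admissible: for every modality $\mu : n \to m$, every context $\Gamma$ ctx $@\,m$, every pre-context $\Delta$, every mode $b$ and formulas $\varphi,\psi$, if $\Gamma.\mathsf{lock}_\mu \vdash \varphi\ @\,n$ and $\Gamma, (\mu\mid\varphi), \Delta \vdash \psi\ @\,b$ are derivable, then $\Gamma, \Delta \vdash \psi\ @\,b$ is derivable.
   Context: A mode theory is a strict 2-category $\mathcal{M}$. Its objects are called modes; its 1-cells $\mu : n \to m$ are called modalities, with composition $\mu\circ\nu : o \to m$ for $\nu : o\to n$, $\mu : n \to m$, and identities $1_m$; its 2-cells $\alpha : \mu \Rightarrow \nu$ (between parallel modalities) are called transformations, with vertical composition, identities $1_\mu$, and horizontal composition $\alpha * \beta : \mu\circ\theta \Rightarrow \nu\circ\xi$ for $\alpha:\mu\Rightarrow\nu$, $\beta : \theta\Rightarrow\xi$, satisfying the strict 2-category laws. Formulas. Pre-formulas: $\varphi,\psi ::= p_i \mid \bot \mid \top \mid \varphi\lor\psi \mid \varphi\land\psi \mid (\mu\mid\varphi)\to\psi \mid \langle\mu\mid\varphi\rangle$. The judgement "$\varphi$ wff $@\,m$" is generated by: $p_i,\top,\bot$ are wff at every mode; if $\varphi,\psi$ wff $@\,m$ then so are $\varphi\land\psi$, $\varphi\lor\psi$; if $\mu:n\to m$, $\varphi$ wff $@\,n$ and $\psi$ wff $@\,m$ then $(\mu\mid\varphi)\to\psi$ wff $@\,m$; if $\varphi$ wff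 $@\,n$ and $\mu:n\to m$ then $\langle\mu\mid\varphi\rangle$ wff $@\,m$. Contexts. Pre-contexts: $\Gamma ::= \cdot \mid \Gamma, (\mu\mid\varphi) \mid \Gamma.\mathsf{lock}_\mu$. The judgement "$\Gamma$ ctx $@\,m$" is generated by: $\cdot$ ctx $@\,m$; if $\Gamma$ ctx $@\,m$, $\mu : n\to m$ and $\varphi$ wff $@\,n$ then $\Gamma,(\mu\mid\varphi)$ ctx $@\,m$; if $\Gamma$ ctx $@\,m$ and $\mu : n \to m$ then $\Gamma.\mathsf{lock}_\mu$ ctx $@\,n$. Contexts are identified modulo $\Gamma.\mathsf{lock}_{1_m} = \Gamma$ and $\Gamma.\mathsf{lock}_\mu.\mathsf{lock}_\nu = \Gamma.\mathsf{lock}_{\mu\circ\nu}$. $\Gamma,\Delta$ denotes concatenation of pre-contexts. Define $|\cdot| = 1$, $|\Gamma,(\mu\mid\varphi)| = |\Gamma|$, $|\Gamma.\mathsf{lock}_\mu| = |\Gamma|\circ\mu$. Derivability of $\Gamma\vdash\varphi\ @\,m$ is generated by the rules: (var) if $\mu : n\to m$ and $\alpha : \mu\Rightarrow |\Delta|$ then $\Gamma,(\mu\mid\varphi),\Delta \vdash \varphi\ @\,n$; ($\top$) $\Gamma\vdash\top\ @\,m$; ($\bot$E) from $\Gamma\vdash\bot\ @\,m$ infer $\Gamma\vdash\varphi\ @\,m$; ($\land$I) from $\Gamma\vdash\varphi$ and $\Gamma\vdash\psi$ infer $\Gamma\vdash\varphi\land\psi$; ($\land$E) from $\Gamma\vdash\varphi_1\land\varphi_2$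 infer $\Gamma\vdash\varphi_i$; ($\lor$I) from $\Gamma\vdash\varphi_i$ infer $\Gamma\vdash\varphi_1\lor\varphi_2$; ($\lor$E) from $\Gamma\vdash\varphi\lor\psi$, $\Gamma,(1\mid\varphi)\vdash C$, $\Gamma,(1\mid\psi)\vdash C$ infer $\Gamma\vdash C$ (all at the same mode); ($\to$I) from $\Gamma,(\mu\mid\varphi)\vdash\psi\ @\,m$ infer $\Gamma\vdash(\mu\mid\varphi)\to\psi\ @\,m$; ($\to$E) if $\mu:n\to m$, from $\Gamma\vdash(\mu\mid\varphi)\to\psi\ @\,m$ and $\Gamma.\mathsf{lock}_\mu\vdash\varphi\ @\,n$ infer $\Gamma\vdash\psi\ @\,m$; (modI) if $\mu:n\to m$, from $\Gamma.\mathsf{lock}_\mu\vdash\varphi\ @\,n$ infer $\Gamma\vdash\langle\mu\mid\varphi\rangle\ @\,m$; (modE) if $\nu:o\to n$, $\mu:n\to m$, from $\Gamma.\mathsf{lock}_\mu\vdash\langle\nu\mid\varphi\rangle\ @\,n$ and $\Gamma,(\mu\circ\nu\mid\varphi)\vdash\psi\ @\,m$ infer $\Gamma\vdash\psi\ @\,m$. A rule is admissible if whenever its premises are derivable, so is its conclusion. *)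

theory Defs
  imports Main
begin

record ('o, 'm, 't) two_category =
  Modes :: "'o set"
  Modalities :: "'m set"
  mdom :: "'m \<Rightarrow> 'o"
  mcod :: "'m \<Rightarrow> 'o"
  mid :: "'o \<Rightarrow> 'm"
  mcomp :: "'m \<Rightarrow> 'm \<Rightarrow> 'm"  (infixl "\<odot>\<index>" 70)
  Transformations :: "'t set"
  tsrc :: "'t \<Rightarrow> 'm"
  ttgt :: "'t \<Rightarrow> 'm"
  tid :: "'m \<Rightarrow> 't"
  vcomp :: "'t \<Rightarrow> 't \<Rightarrow> 't"  (infixl "\<cdot>\<index>" 70)
  hcomp :: "'t \<Rightarrow> 't \<Rightarrow> 't"  (infixl "\<star>\<index>" 70)

definition modality :: "('o, 'm, 't, 'x) two_category_scheme \<Rightarrow> 'm \<Rightarrow> 'o \<Rightarrow> 'o \<Rightarrow> bool" where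
  "modality M \<mu> n m \<longleftrightarrow> \<mu> \<in> Modalities M \<and> mdom M \<mu> = n \<and> mcod M \<mu> = m"

definition transformation :: "('o, 'm, 't, 'x) two_category_scheme \<Rightarrow> 't \<Rightarrow> 'm \<Rightarrow> 'm \<Rightarrow> bool" where
  "transformation M \<alpha> \<mu> \<nu> \<longleftrightarrow> \<alpha> \<in> Transformations M \<and> tsrc M \<alpha> = \<mu> \<and> ttgt M \<alpha> = \<nu>"

text \<open>
  Strict 2-categories. All compositions are written in applicative order:
  \<open>\<mu> \<odot> \<nu>\<close> is \<open>\<mu>\<close> after \<open>\<nu>\<close>, and \<open>\<beta> \<cdot> \<alpha>\<close> is \<open>\<beta>\<close> after \<open>\<alpha>\<close>.
  Operations are unconstrained outside their domains.
\<close>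

locale mode_theory =
  fixes M :: "('o, 'm, 't, 'x) two_category_scheme" (structure)
  assumes modality_modes: "modality M \<mu> n m \<Longrightarrow> n \<in> Modes M \<and> m \<in> Modes M"
    and mid_modality: "m \<in> Modes M \<Longrightarrow> modality M (mid M m) m m"
    and mcomp_modality: "modality M \<mu> n m \<Longrightarrow> modality M \<nu> l n \<Longrightarrow> modality M (\<mu> \<odot> \<nu>) l m"
    and mcomp_mid_left: "modality M \<mu> n m \<Longrightarrow> mid M m \<odot> \<mu> = \<mu>"
    and mcomp_mid_right: "modality M \<mu> n m \<Longrightarrow> \<mu> \<odot> mid M n = \<mu>"
    and mcomp_assoc:
      "modality M \<mu> n m \<Longrightarrow> modality M \<nu> l n \<Longrightarrow> modality M \<rho> k l \<Longrightarrow>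
        \<mu> \<odot> \<nu> \<odot> \<rho> = \<mu> \<odot> (\<nu> \<odot> \<rho>)"
    and transformation_parallel:
      "transformation M \<alpha> \<mu> \<nu> \<Longrightarrow> \<exists>n m. modality M \<mu> n m \<and> modality M \<nu> n m"
    and tid_transformation: "modality M \<mu> n m \<Longrightarrow> transformation M (tid M \<mu>) \<mu> \<mu>"
    and vcomp_transformation:
      "transformation M \<alpha> \<mu> \<nu> \<Longrightarrow> transformation M \<beta> \<nu> \<rho> \<Longrightarrow> transformation M (\<beta> \<cdot> \<alpha>) \<mu> \<rho>"
    and vcomp_tid_left: "transformation M \<alpha> \<mu> \<nu> \<Longrightarrow> tid M \<nu> \<cdot> \<alpha> = \<alpha>"
    and vcomp_tid_right: "transformation M \<alpha> \<mu> \<nu> \<Longrightarrow> \<alpha> \<cdot> tid M \<mu> = \<alpha>"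
    and vcomp_assoc:
      "transformation M \<alpha> \<mu> \<nu> \<Longrightarrow> transformation M \<beta> \<nu> \<rho> \<Longrightarrow> transformation M \<gamma> \<rho> \<sigma> \<Longrightarrow>
        \<gamma> \<cdot> \<beta> \<cdot> \<alpha> = \<gamma> \<cdot> (\<beta> \<cdot> \<alpha>)"
    and hcomp_transformation:
      "transformation M \<alpha> \<mu> \<nu> \<Longrightarrow> transformation M \<beta> \<theta> \<xi> \<Longrightarrow>
        modality M \<mu> n m \<Longrightarrow> modality M \<theta> l n \<Longrightarrow> transformation M (\<alpha> \<star> \<beta>) (\<mu> \<odot> \<theta>) (\<nu> \<odot> \<xi>)"
    and hcomp_tid_left:
      "transformation M \<alpha> \<mu> \<nu> \<Longrightarrow> modality M \<mu> n m \<Longrightarrow> tid M (mid M m) \<star> \<alpha> = \<alpha>"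
    and hcomp_tid_right:
      "transformation M \<alpha> \<mu> \<nu> \<Longrightarrow> modality M \<mu> n m \<Longrightarrow> \<alpha> \<star> tid M (mid M n) = \<alpha>"
    and hcomp_assoc:
      "transformation M \<alpha> \<mu> \<mu>' \<Longrightarrow> transformation M \<beta> \<nu> \<nu>' \<Longrightarrow> transformation M \<gamma> \<rho> \<rho>' \<Longrightarrow>
        modality M \<mu> n m \<Longrightarrow> modality M \<nu> l n \<Longrightarrow> modality M \<rho> k l \<Longrightarrow>
        \<alpha> \<star> \<beta> \<star> \<gamma> = \<alpha> \<star> (\<beta> \<star> \<gamma>)"
    and hcomp_tid_tid:
      "modality M \<mu> n m \<Longrightarrow> modality M \<nu> l n \<Longrightarrow> tid M \<mu> \<star> tid M \<nu> = tid M (\<mu> \<odot> \<nu>)"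
    and interchange:
      "transformation M \<alpha> \<mu>\<^sub>1 \<mu>\<^sub>2 \<Longrightarrow> transformation M \<alpha>' \<mu>\<^sub>2 \<mu>\<^sub>3 \<Longrightarrow>
        transformation M \<beta> \<nu>\<^sub>1 \<nu>\<^sub>2 \<Longrightarrow> transformation M \<beta>' \<nu>\<^sub>2 \<nu>\<^sub>3 \<Longrightarrow>
        modality M \<mu>\<^sub>1 n m \<Longrightarrow> modality M \<nu>\<^sub>1 l n \<Longrightarrow>
        (\<alpha>' \<cdot> \<alpha>) \<star> (\<beta>' \<cdot> \<beta>) = (\<alpha>' \<star> \<beta>') \<cdot> (\<alpha> \<star> \<beta>)"

datatype 'm fm =
    Atom nat
  | Bot
  | Top
  | Disj "'m fm" "'m fm"
  | Conj "'m fm" "'m fm"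
  | Imp 'm "'m fm" "'m fm"
  | Modal 'm "'m fm"

text \<open>\<open>Imp \<mu> \<phi> \<psi>\<close> is \<open>(\<mu> | \<phi>) \<rightarrow> \<psi>\<close> and \<open>Modal \<mu> \<phi>\<close> is \<open>\<langle>\<mu> | \<phi>\<rangle>\<close>.\<close>

inductive wff :: "('o, 'm, 't, 'x) two_category_scheme \<Rightarrow> 'm fm \<Rightarrow> 'o \<Rightarrow> bool"
  for M :: "('o, 'm, 't, 'x) two_category_scheme" where
  wff_Atom: "m \<in> Modes M \<Longrightarrow> wff M (Atom i) m"
| wff_Bot: "m \<in> Modes M \<Longrightarrow> wff M Bot m"
| wff_Top: "m \<in> Modes M \<Longrightarrow> wff M Top m"
| wff_Disj: "wff M \<phi> m \<Longrightarrow> wff M \<psi> m \<Longrightarrow> wff M (Disj \<phi> \<psi>) m"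
| wff_Conj: "wff M \<phi> m \<Longrightarrow> wff M \<psi> m \<Longrightarrow> wff M (Conj \<phi> \<psi>) m"
| wff_Imp: "modality M \<mu> n m \<Longrightarrow> wff M \<phi> n \<Longrightarrow> wff M \<psi> m \<Longrightarrow> wff M (Imp \<mu> \<phi> \<psi>) m"
| wff_Modal: "modality M \<mu> n m \<Longrightarrow> wff M \<phi> n \<Longrightarrow> wff M (Modal \<mu> \<phi>) m"

datatype 'm pctx =
    Emp
  | Ext "'m pctx" 'm "'m fm"
  | Lock "'m pctx" 'm

primrec pctx_append :: "'m pctx \<Rightarrow> 'm pctx \<Rightarrow> 'm pctx"  (infixl "\<frown>" 65) where
  "\<Gamma> \<frown> Emp = \<Gamma>"
| "\<Gamma> \<frown> Ext \<Delta> \<mu> \<phi> = Ext (\<Gamma> \<frown> \<Delta>) \<mu> \<phi>"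
| "\<Gamma> \<frown> Lock \<Delta> \<mu> = Lock (\<Gamma> \<frown> \<Delta>) \<mu>"

inductive ctx :: "('o, 'm, 't, 'x) two_category_scheme \<Rightarrow> 'm pctx \<Rightarrow> 'o \<Rightarrow> bool"
  for M :: "('o, 'm, 't, 'x) two_category_scheme" where
  ctx_Emp: "m \<in> Modes M \<Longrightarrow> ctx M Emp m"
| ctx_Ext: "ctx M \<Gamma> m \<Longrightarrow> modality M \<mu> n m \<Longrightarrow> wff M \<phi> n \<Longrightarrow> ctx M (Ext \<Gamma> \<mu> \<phi>) m"
| ctx_Lock: "ctx M \<Gamma> m \<Longrightarrow> modality M \<mu> n m \<Longrightarrow> ctx M (Lock \<Gamma> \<mu>) n"

text \<open>
  The identification of contexts is the least congruence containing the two lock equations. It is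
  indexed by the mode of the contexts, since the empty context is well formed at every mode:
  without the index, transitivity through \<open>Emp\<close> would relate
  \<open>Lock Emp (mid M m)\<close> and \<open>Lock Emp (mid M n)\<close> for distinct \<open>m\<close> and \<open>n\<close>.
\<close>

inductive ctx_eq :: "('o, 'm, 't, 'x) two_category_scheme \<Rightarrow> 'm pctx \<Rightarrow> 'm pctx \<Rightarrow> 'o \<Rightarrow> bool"
  for M :: "('o, 'm, 't, 'x) two_category_scheme" where
  ctx_eq_lock_id: "ctx M \<Gamma> m \<Longrightarrow> ctx_eq M (Lock \<Gamma> (mid M m)) \<Gamma> m"
| ctx_eq_lock_comp:
    "ctx M \<Gamma> m \<Longrightarrow> modality M \<mu> n m \<Longrightarrow> modality M \<nu> l n \<Longrightarrow>
      ctx_eq M (Lock (Lock \<Gamma> \<mu>) \<nu>) (Lock \<Gamma> (\<mu> \<odot>\<^bsub>M\<^esub> \<nu>)) l"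
| ctx_eq_refl: "ctx M \<Gamma> m \<Longrightarrow> ctx_eq M \<Gamma> \<Gamma> m"
| ctx_eq_sym: "ctx_eq M \<Gamma> \<Gamma>' m \<Longrightarrow> ctx_eq M \<Gamma>' \<Gamma> m"
| ctx_eq_trans: "ctx_eq M \<Gamma> \<Gamma>' m \<Longrightarrow> ctx_eq M \<Gamma>' \<Gamma>'' m \<Longrightarrow> ctx_eq M \<Gamma> \<Gamma>'' m"
| ctx_eq_Ext:
    "ctx_eq M \<Gamma> \<Gamma>' m \<Longrightarrow> modality M \<mu> n m \<Longrightarrow> wff M \<phi> n \<Longrightarrow>
      ctx_eq M (Ext \<Gamma> \<mu> \<phi>) (Ext \<Gamma>' \<mu> \<phi>) m"
| ctx_eq_Lock:
    "ctx_eq M \<Gamma> \<Gamma>' m \<Longrightarrow> modality M \<mu> n m \<Longrightarrow> ctx_eq M (Lock \<Gamma> \<mu>) (Lock \<Gamma>' \<mu>) n"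

text \<open>
  \<open>locks M m \<Delta>\<close> is \<open>|\<Delta>|\<close> for a pre-context \<open>\<Delta>\<close> that extends a context at mode \<open>m\<close>;
  the mode determines which identity \<open>|\<cdot>| = 1\<close> is.
\<close>

primrec locks :: "('o, 'm, 't, 'x) two_category_scheme \<Rightarrow> 'o \<Rightarrow> 'm pctx \<Rightarrow> 'm" where
  "locks M m Emp = mid M m"
| "locks M m (Ext \<Gamma> \<mu> \<phi>) = locks M m \<Gamma>"
| "locks M m (Lock \<Gamma> \<mu>) = locks M m \<Gamma> \<odot>\<^bsub>M\<^esub> \<mu>"

text \<open>
  \<open>derives M \<Gamma> \<phi> m\<close> is \<open>\<Gamma> \<turnstile> \<phi> @ m\<close>, which presupposes that \<open>\<Gamma>\<close> is a context and \<open>\<phi>\<close> a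
  formula at \<open>m\<close>; rules carry a well-formedness premise exactly where it does not follow from the
  other premises (see \<open>derives_well_formed\<close>). The rule \<open>conv\<close> implements the identification of
  contexts: derivability is a predicate on equivalence classes of contexts.
\<close>

inductive derives :: "('o, 'm, 't, 'x) two_category_scheme \<Rightarrow> 'm pctx \<Rightarrow> 'm fm \<Rightarrow> 'o \<Rightarrow> bool"
  for M :: "('o, 'm, 't, 'x) two_category_scheme" where
  conv: "derives M \<Gamma> \<phi> m \<Longrightarrow> ctx_eq M \<Gamma> \<Gamma>' m \<Longrightarrow> derives M \<Gamma>' \<phi> m"
| var:
    "modality M \<mu> n m \<Longrightarrow> transformation M \<alpha> \<mu> (locks M m \<Delta>) \<Longrightarrow>
      ctx M (Ext \<Gamma> \<mu> \<phi> \<frown> \<Delta>) n \<Longrightarrow> derives M (Ext \<Gamma> \<mu> \<phi> \<frown> \<Delta>) \<phi> n"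
| TopI: "ctx M \<Gamma> m \<Longrightarrow> derives M \<Gamma> Top m"
| BotE: "derives M \<Gamma> Bot m \<Longrightarrow> wff M \<phi> m \<Longrightarrow> derives M \<Gamma> \<phi> m"
| ConjI: "derives M \<Gamma> \<phi> m \<Longrightarrow> derives M \<Gamma> \<psi> m \<Longrightarrow> derives M \<Gamma> (Conj \<phi> \<psi>) m"
| ConjE1: "derives M \<Gamma> (Conj \<phi> \<psi>) m \<Longrightarrow> derives M \<Gamma> \<phi> m"
| ConjE2: "derives M \<Gamma> (Conj \<phi> \<psi>) m \<Longrightarrow> derives M \<Gamma> \<psi> m"
| DisjI1: "derives M \<Gamma> \<phi> m \<Longrightarrow> wff M \<psi> m \<Longrightarrow> derives M \<Gamma> (Disj \<phi> \<psi>) m"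
| DisjI2: "derives M \<Gamma> \<psi> m \<Longrightarrow> wff M \<phi> m \<Longrightarrow> derives M \<Gamma> (Disj \<phi> \<psi>) m"
| DisjE:
    "derives M \<Gamma> (Disj \<phi> \<psi>) m \<Longrightarrow> derives M (Ext \<Gamma> (mid M m) \<phi>) \<chi> m \<Longrightarrow>
      derives M (Ext \<Gamma> (mid M m) \<psi>) \<chi> m \<Longrightarrow> derives M \<Gamma> \<chi> m"
| ImpI: "derives M (Ext \<Gamma> \<mu> \<phi>) \<psi> m \<Longrightarrow> derives M \<Gamma> (Imp \<mu> \<phi> \<psi>) m"
| ImpE:
    "modality M \<mu> n m \<Longrightarrow> derives M \<Gamma> (Imp \<mu> \<phi> \<psi>) m \<Longrightarrow> derives M (Lock \<Gamma> \<mu>) \<phi> n \<Longrightarrow>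
      derives M \<Gamma> \<psi> m"
| ModalI:
    "modality M \<mu> n m \<Longrightarrow> derives M (Lock \<Gamma> \<mu>) \<phi> n \<Longrightarrow> derives M \<Gamma> (Modal \<mu> \<phi>) m"
| ModalE:
    "modality M \<nu> l n \<Longrightarrow> modality M \<mu> n m \<Longrightarrow> derives M (Lock \<Gamma> \<mu>) (Modal \<nu> \<phi>) n \<Longrightarrow>
      derives M (Ext \<Gamma> (\<mu> \<odot>\<^bsub>M\<^esub> \<nu>) \<phi>) \<psi> m \<Longrightarrow> derives M \<Gamma> \<psi> m"

inductive_cases wff_DisjE: "wff M (Disj \<phi> \<psi>) m"
inductive_cases wff_ConjE: "wff M (Conj \<phi> \<psi>) m"
inductive_cases wff_ImpE: "wff M (Imp \<mu> \<phi> \<psi>) m"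
inductive_cases ctx_ExtE: "ctx M (Ext \<Gamma> \<mu> \<phi>) m"
inductive_cases ctx_LockE: "ctx M (Lock \<Gamma> \<mu>) m"

context mode_theory
begin

lemma ctx_mode: "ctx M \<Gamma> m \<Longrightarrow> m \<in> Modes M"
  by (induction rule: ctx.induct) (auto dest: modality_modes)

lemma ctx_eq_well_formed: "ctx_eq M \<Gamma> \<Gamma>' m \<Longrightarrow> ctx M \<Gamma> m \<and> ctx M \<Gamma>' m"
  by (induction rule: ctx_eq.induct)
    (auto intro: ctx.intros mid_modality mcomp_modality dest: ctx_mode)

lemma ctx_append_Ext:
  "ctx M (Ext \<Gamma> \<mu> \<phi> \<frown> \<Delta>) b \<Longrightarrow> \<exists>m. ctx M (Ext \<Gamma> \<mu> \<phi>) m \<and> modality M (locks M m \<Delta>) b m"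
proof (induction \<Delta> arbitrary: b)
  case Emp
  then show ?case by (auto intro: mid_modality dest: ctx_mode)
next
  case (Ext \<Delta> \<nu> \<psi>)
  then show ?case by (auto elim!: ctx_ExtE)
next
  case (Lock \<Delta> \<nu>)
  then show ?case by (fastforce elim!: ctx_LockE intro: mcomp_modality)
qed

lemma derives_well_formed: "derives M \<Gamma> \<phi> m \<Longrightarrow> ctx M \<Gamma> m \<and> wff M \<phi> m"
proof (induction rule: derives.induct)
  case (var \<mu> n m \<alpha> \<Delta> \<Gamma> \<phi>)
  then show ?case
    by (fastforce dest: ctx_append_Ext elim!: ctx_ExtE simp: modality_def)
qed (auto elim!: wff_DisjE wff_ConjE wff_ImpE ctx_ExtE ctx_LockE simp: modality_def
  intro: wff.intros dest: ctx_eq_well_formed ctx_mode)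

end

end

theory Submission
  imports Defs
begin

text \<open>
  A context matters only through its entries: the hypotheses \<open>(\<mu> | \<phi>)\<close> in it, each paired with
  the composite \<open>\<nu>\<close> of the locks to its right. Entries are invariant under the identification of
  contexts, and the variable rule asks for a 2-cell \<open>\<mu> \<Rightarrow> \<nu>\<close>. A renaming sends each
  entry to one with the same hypothesis and a 2-cell between the lock composites; a substitution
  sends each entry to a derivation of every instance of the variable rule, stably under further
  locks. Both are preserved by locks and by context extension, so both act on derivations;
  extending a substitution uses weakening, which is a renaming. A cut is a substitution: for the
  removed hypothesis, a 2-cell \<open>\<alpha> : \<mu> \<Rightarrow> |\<Delta>| \<circ> \<rho>\<close> whiskers to a renaming from
  \<open>\<Gamma>.lock \<mu>\<close> to \<open>(\<Gamma>, \<Delta>).lock \<rho>\<close>.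
\<close>

section \<open>Entries of pre-contexts\<close>

text \<open>The codomain of the modality of a hypothesis is the mode at which its lock composite
  starts, so \<open>mcod M \<mu>\<close> takes over the mode argument of
  \<open>locks\<close>.\<close>

primrec entries ::
    "('o, 'm, 't, 'x) two_category_scheme \<Rightarrow> 'm pctx \<Rightarrow> ('m \<times> 'm fm \<times> 'm) set" where
  "entries M Emp = {}"
| "entries M (Ext \<Gamma> \<mu> \<phi>) = insert (\<mu>, \<phi>, mid M (mcod M \<mu>)) (entries M \<Gamma>)"
| "entries M (Lock \<Gamma> \<mu>) = (\<lambda>(\<kappa>, \<phi>, \<nu>). (\<kappa>, \<phi>, \<nu> \<odot>\<^bsub>M\<^esub> \<mu>)) ` entries M \<Gamma>"

lemma modality_cod: "modality M \<mu> n m \<Longrightarrow> mcod M \<mu> = m"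
  by (simp add: modality_def)

lemma modality_unique: "modality M \<mu> n m \<Longrightarrow> modality M \<mu> n' m' \<Longrightarrow> n = n' \<and> m = m'"
  by (simp add: modality_def)

text \<open>The locks in \<Delta> act on each entry separately, so a hypothesis in the middle
  contributes one entry of its own; this is the entry that a cut has to account for.\<close>

lemma entries_Ext_append:
  "entries M (Ext \<Gamma> \<mu> \<phi> \<frown> \<Delta>) =
    insert (\<mu>, \<phi>, locks M (mcod M \<mu>) \<Delta>) (entries M (\<Gamma> \<frown> \<Delta>))"
  by (induction \<Delta>) (auto simp: insert_commute)

text \<open>Recovers from an entry the syntactic shape that rule \<open>var\<close> demands.\<close>

lemma entries_split:
  "(\<mu>, \<phi>, \<nu>) \<in> entries M \<Gamma> \<Longrightarrow>
    \<exists>\<Gamma>\<^sub>0 \<Delta>. \<Gamma> = Ext \<Gamma>\<^sub>0 \<mu> \<phi> \<frown> \<Delta> \<and> \<nu> = locks M (mcod M \<mu>) \<Delta>"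
proof (induction \<Gamma> arbitrary: \<nu>)
  case Emp
  then show ?case by simp
next
  case (Ext \<Gamma> \<kappa> \<psi>)
  from Ext.prems consider "\<mu> = \<kappa>" "\<phi> = \<psi>" "\<nu> = mid M (mcod M \<kappa>)" | "(\<mu>, \<phi>, \<nu>) \<in> entries M \<Gamma>"
    by auto
  then show ?case
  proof cases
    case 1
    then have "Ext \<Gamma> \<kappa> \<psi> = Ext \<Gamma> \<mu> \<phi> \<frown> Emp \<and> \<nu> = locks M (mcod M \<mu>) Emp" by simp
    then show ?thesis by blast
  next
    case 2
    then obtain \<Gamma>\<^sub>0 \<Delta> where "\<Gamma> = Ext \<Gamma>\<^sub>0 \<mu> \<phi> \<frown> \<Delta>" "\<nu> = locks M (mcod M \<mu>) \<Delta>"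
      using Ext.IH by blast
    then have "Ext \<Gamma> \<kappa> \<psi> = Ext \<Gamma>\<^sub>0 \<mu> \<phi> \<frown> Ext \<Delta> \<kappa> \<psi> \<and> \<nu> = locks M (mcod M \<mu>) (Ext \<Delta> \<kappa> \<psi>)"
      by simp
    then show ?thesis by blast
  qed
next
  case (Lock \<Gamma> \<kappa>)
  then obtain \<nu>' where "(\<mu>, \<phi>, \<nu>') \<in> entries M \<Gamma>" and \<nu>: "\<nu> = \<nu>' \<odot>\<^bsub>M\<^esub> \<kappa>" by auto
  then obtain \<Gamma>\<^sub>0 \<Delta> where "\<Gamma> = Ext \<Gamma>\<^sub>0 \<mu> \<phi> \<frown> \<Delta>" "\<nu>' = locks M (mcod M \<mu>) \<Delta>"
    using Lock.IH by blast
  with \<nu> have "Lock \<Gamma> \<kappa> = Ext \<Gamma>\<^sub>0 \<mu> \<phi> \<frown> Lock \<Delta> \<kappa> \<and> \<nu> = locks M (mcod M \<mu>) (Lock \<Delta> \<kappa>)"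
    by simp
  then show ?case by blast
qed

context mode_theory
begin

text \<open>Supplies the typing under which the laws of the 2-category apply to lock
  composites.\<close>

lemma entries_modality: "ctx M \<Gamma> m \<Longrightarrow> (\<mu>, \<phi>, \<nu>) \<in> entries M \<Gamma> \<Longrightarrow> modality M \<nu> m (mcod M \<mu>)"
  by (induction arbitrary: \<nu> rule: ctx.induct)
    (auto intro: mid_modality[OF ctx_mode] mcomp_modality simp: modality_cod)

text \<open>On entries, the two lock equations become the right unit law and associativity of
  composition of modalities.\<close>

lemma ctx_eq_entries: "ctx_eq M \<Gamma> \<Gamma>' m \<Longrightarrow> entries M \<Gamma> = entries M \<Gamma>'"
proof (induction rule: ctx_eq.induct)
  case (ctx_eq_lock_id \<Gamma> m)
  have "entries M (Lock \<Gamma> (mid M m)) = id ` entries M \<Gamma>"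
    unfolding entries.simps
    by (rule image_cong) (auto simp: mcomp_mid_right[OF entries_modality[OF ctx_eq_lock_id]])
  then show ?case by simp
next
  case (ctx_eq_lock_comp \<Gamma> m \<mu> n \<nu> l)
  show ?case
    unfolding entries.simps image_image
    by (rule image_cong)
      (auto simp: mcomp_assoc[OF entries_modality[OF ctx_eq_lock_comp(1)] ctx_eq_lock_comp(2,3)])
qed auto

lemma derives_entry:
  assumes "ctx M \<Gamma> n" and "(\<mu>, \<phi>, \<nu>) \<in> entries M \<Gamma>" and \<alpha>: "transformation M \<alpha> \<mu> \<nu>"
  shows "derives M \<Gamma> \<phi> n"
proof -
  obtain \<Gamma>\<^sub>0 \<Delta> where *: "\<Gamma> = Ext \<Gamma>\<^sub>0 \<mu> \<phi> \<frown> \<Delta>" "\<nu> = locks M (mcod M \<mu>) \<Delta>"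
    using entries_split[OF assms(2)] by blast
  \<comment> \<open>The 2-cell makes \<mu> parallel to \<nu>, whose domain is the mode of the
    context.\<close>
  have "modality M \<mu> n (mcod M \<mu>)"
    using entries_modality[OF assms(1,2)] transformation_parallel[OF \<alpha>]
    by (auto simp: modality_def)
  then show ?thesis using assms * by (auto intro: derives.var)
qed

lemma derives_Lock_entry:
  assumes "ctx M \<Gamma> m" and "modality M \<rho> k m"
    and "(\<mu>, \<phi>, \<nu>) \<in> entries M \<Gamma>" and "transformation M \<alpha> \<mu> (\<nu> \<odot> \<rho>)"
  shows "derives M (Lock \<Gamma> \<rho>) \<phi> k"
  using assms by (intro derives_entry[where \<mu> = \<mu> and \<nu> = "\<nu> \<odot> \<rho>"]) (force intro: ctx_Lock)+

section \<open>Induction on derivations\<close>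

text \<open>One induction serves renamings and substitutions, which differ only in the variable
  case. Rules that bind or lock need the closure conditions \<open>R_Ext\<close> and
  \<open>R_Lock\<close>.\<close>

lemma derives_transport:
  assumes "derives M \<Gamma> \<phi> m" and "R \<Gamma> \<Gamma>' m"
    and R_ctx: "\<And>\<Gamma> \<Gamma>' m. R \<Gamma> \<Gamma>' m \<Longrightarrow> ctx M \<Gamma>' m"
    and R_eq: "\<And>\<Gamma>\<^sub>0 \<Gamma> \<Gamma>' m. R \<Gamma> \<Gamma>' m \<Longrightarrow> ctx_eq M \<Gamma>\<^sub>0 \<Gamma> m \<Longrightarrow> R \<Gamma>\<^sub>0 \<Gamma>' m"
    and R_var: "\<And>\<Gamma> \<Gamma>' \<mu> \<phi> \<nu> \<alpha> n. R \<Gamma> \<Gamma>' n \<Longrightarrow> (\<mu>, \<phi>, \<nu>) \<in> entries M \<Gamma> \<Longrightarrow>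
      transformation M \<alpha> \<mu> \<nu> \<Longrightarrow> derives M \<Gamma>' \<phi> n"
    and R_Ext: "\<And>\<Gamma> \<Gamma>' \<mu> \<phi> n m. R \<Gamma> \<Gamma>' m \<Longrightarrow> modality M \<mu> n m \<Longrightarrow> wff M \<phi> n \<Longrightarrow>
      R (Ext \<Gamma> \<mu> \<phi>) (Ext \<Gamma>' \<mu> \<phi>) m"
    and R_Lock: "\<And>\<Gamma> \<Gamma>' \<mu> n m. R \<Gamma> \<Gamma>' m \<Longrightarrow> modality M \<mu> n m \<Longrightarrow>
      R (Lock \<Gamma> \<mu>) (Lock \<Gamma>' \<mu>) n"
  shows "derives M \<Gamma>' \<phi> m"
proof -
  \<comment> \<open>The typing of a bound hypothesis is read off from the well-formedness of the
    premise that contains it.\<close>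
  have R_Ext': "R (Ext \<Gamma> \<mu> \<phi>) (Ext \<Gamma>' \<mu> \<phi>) m"
    if "R \<Gamma> \<Gamma>' m" "derives M (Ext \<Gamma> \<mu> \<phi>) \<psi> m" for \<Gamma> \<Gamma>' \<mu> \<phi> \<psi> m
    using that by (auto dest!: derives_well_formed elim!: ctx_ExtE intro: R_Ext)
  show ?thesis
    using assms(1,2)
  proof (induction arbitrary: \<Gamma>' rule: derives.induct)
    \<comment> \<open>\<open>R\<close> is given for the converted context while the induction
      hypothesis concerns the original one; hence the direction of \<open>R_eq\<close>.\<close>
    case (conv \<Gamma> \<phi> m \<Gamma>\<^sub>1)
    then show ?case by (blast intro: R_eq)
  next
    case (var \<mu> n m \<alpha> \<Delta> \<Gamma> \<phi>)
    have "(\<mu>, \<phi>, locks M m \<Delta>) \<in> entries M (Ext \<Gamma> \<mu> \<phi> \<frown> \<Delta>)"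
      using modality_cod[OF var(1)] by (simp add: entries_Ext_append)
    then show ?case using var by (blast intro: R_var)
  next
    case (TopI \<Gamma> m)
    then show ?case by (blast intro: derives.TopI R_ctx)
  next
    case (BotE \<Gamma> m \<phi>)
    then show ?case by (blast intro: derives.BotE)
  next
    case (ConjI \<Gamma> \<phi> m \<psi>)
    then show ?case by (blast intro: derives.ConjI)
  next
    case (ConjE1 \<Gamma> \<phi> \<psi> m)
    then show ?case by (blast intro: derives.ConjE1)
  next
    case (ConjE2 \<Gamma> \<phi> \<psi> m)
    then show ?case by (blast intro: derives.ConjE2)
  next
    case (DisjI1 \<Gamma> \<phi> m \<psi>)
    then show ?case by (blast intro: derives.DisjI1)
  next
    case (DisjI2 \<Gamma> \<psi> m \<phi>)
    then show ?case by (blast intro: derives.DisjI2)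
  next
    case (DisjE \<Gamma> \<phi> \<psi> m \<chi>)
    show ?case
      by (rule derives.DisjE[OF DisjE.IH(1) DisjE.IH(2) DisjE.IH(3)])
        (use DisjE.prems DisjE.hyps in \<open>blast intro: R_Ext'\<close>)+
  next
    case (ImpI \<Gamma> \<mu> \<phi> \<psi> m)
    then show ?case by (blast intro: derives.ImpI R_Ext')
  next
    case (ImpE \<mu> n m \<Gamma> \<phi> \<psi>)
    show ?case
      by (rule derives.ImpE[OF ImpE.hyps(1) ImpE.IH(1) ImpE.IH(2)])
        (use ImpE.prems ImpE.hyps(1) in \<open>blast intro: R_Lock\<close>)+
  next
    case (ModalI \<mu> n m \<Gamma> \<phi>)
    then show ?case by (blast intro: derives.ModalI R_Lock)
  next
    case (ModalE \<nu> l n \<mu> m \<Gamma> \<phi> \<psi>)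
    show ?case
      by (rule derives.ModalE[OF ModalE.hyps(1,2) ModalE.IH(1) ModalE.IH(2)])
        (use ModalE.prems ModalE.hyps in \<open>blast intro: R_Lock R_Ext'\<close>)+
  qed
qed

section \<open>Renamings\<close>

text \<open>The 2-cell points from \<nu> to \<open>\<nu>'\<close> so that it composes vertically
  with a cell \<mu> \<Rightarrow> \<nu> of the variable rule.\<close>

definition renaming :: "'m pctx \<Rightarrow> 'm pctx \<Rightarrow> 'o \<Rightarrow> bool" where
  "renaming \<Gamma> \<Gamma>' m \<longleftrightarrow> ctx M \<Gamma> m \<and> ctx M \<Gamma>' m \<and>
    (\<forall>\<mu> \<phi> \<nu>. (\<mu>, \<phi>, \<nu>) \<in> entries M \<Gamma> \<longrightarrow>
      (\<exists>\<nu>' \<beta>. (\<mu>, \<phi>, \<nu>') \<in> entries M \<Gamma>' \<and> transformation M \<beta> \<nu> \<nu>'))"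

lemma renaming_Ext:
  assumes "renaming \<Gamma> \<Gamma>' m" and \<mu>: "modality M \<mu> n m" and "wff M \<phi> n"
  shows "renaming (Ext \<Gamma> \<mu> \<phi>) (Ext \<Gamma>' \<mu> \<phi>) m"
proof -
  have "transformation M (tid M (mid M m)) (mid M m) (mid M m)"
    using \<mu> by (blast intro: tid_transformation mid_modality dest: modality_modes)
  then show ?thesis
    using assms unfolding renaming_def by (auto simp: modality_cod intro: ctx_Ext; blast)
qed

text \<open>A lock composes onto the right of every composite, so right whiskering by \<mu> yields
  the new 2-cells.\<close>

lemma renaming_Lock:
  assumes r: "renaming \<Gamma> \<Gamma>' m" and \<mu>: "modality M \<mu> n m"
  shows "renaming (Lock \<Gamma> \<mu>) (Lock \<Gamma>' \<mu>) n"
  unfolding renaming_def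
proof (intro conjI allI impI)
  show "ctx M (Lock \<Gamma> \<mu>) n" "ctx M (Lock \<Gamma>' \<mu>) n"
    using assms by (auto simp: renaming_def intro: ctx_Lock)
  fix \<kappa> \<phi> \<nu> assume "(\<kappa>, \<phi>, \<nu>) \<in> entries M (Lock \<Gamma> \<mu>)"
  then obtain \<nu>\<^sub>0 where e: "(\<kappa>, \<phi>, \<nu>\<^sub>0) \<in> entries M \<Gamma>" and \<nu>: "\<nu> = \<nu>\<^sub>0 \<odot> \<mu>" by auto
  then obtain \<nu>' \<beta> where e': "(\<kappa>, \<phi>, \<nu>') \<in> entries M \<Gamma>'" and \<beta>: "transformation M \<beta> \<nu>\<^sub>0 \<nu>'"
    using r unfolding renaming_def by blast
  have "modality M \<nu>\<^sub>0 m (mcod M \<kappa>)" using r e by (auto simp: renaming_def dest: entries_modality)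
  then have "transformation M (\<beta> \<star> tid M \<mu>) (\<nu>\<^sub>0 \<odot> \<mu>) (\<nu>' \<odot> \<mu>)"
    using hcomp_transformation[OF \<beta> tid_transformation[OF \<mu>]] \<mu> by blast
  moreover have "(\<kappa>, \<phi>, \<nu>' \<odot> \<mu>) \<in> entries M (Lock \<Gamma>' \<mu>)" using e' by force
  ultimately show "\<exists>\<nu>' \<beta>. (\<kappa>, \<phi>, \<nu>') \<in> entries M (Lock \<Gamma>' \<mu>) \<and> transformation M \<beta> \<nu> \<nu>'"
    using \<nu> by blast
qed

lemma derives_renaming:
  assumes "derives M \<Gamma> \<phi> m" and "renaming \<Gamma> \<Gamma>' m"
  shows "derives M \<Gamma>' \<phi> m"
  using assms
proof (rule derives_transport[where R = renaming])
  fix \<Gamma> \<Gamma>' \<mu> \<phi> \<nu> \<alpha> n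
  assume r: "renaming \<Gamma> \<Gamma>' n" and e: "(\<mu>, \<phi>, \<nu>) \<in> entries M \<Gamma>" and \<alpha>: "transformation M \<alpha> \<mu> \<nu>"
  then obtain \<nu>' \<beta> where "(\<mu>, \<phi>, \<nu>') \<in> entries M \<Gamma>'" "transformation M \<beta> \<nu> \<nu>'"
    unfolding renaming_def by blast
  then show "derives M \<Gamma>' \<phi> n"
    using r derives_entry vcomp_transformation[OF \<alpha>] unfolding renaming_def by blast
next
  fix \<Gamma>\<^sub>0 \<Gamma> \<Gamma>' m
  assume "renaming \<Gamma> \<Gamma>' m" "ctx_eq M \<Gamma>\<^sub>0 \<Gamma> m"
  then show "renaming \<Gamma>\<^sub>0 \<Gamma>' m"
    by (simp add: renaming_def ctx_eq_entries ctx_eq_well_formed)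
qed (simp add: renaming_def, (rule renaming_Ext renaming_Lock; assumption)+)

text \<open>Identity 2-cells suffice. This is the form in which weakening is used.\<close>

lemma renaming_subset:
  assumes "ctx M \<Gamma> m" and "ctx M \<Gamma>' m" and "entries M \<Gamma> \<subseteq> entries M \<Gamma>'"
  shows "renaming \<Gamma> \<Gamma>' m"
  unfolding renaming_def
  using assms by (blast intro: tid_transformation entries_modality)

section \<open>Substitutions\<close>

text \<open>Quantifying over \<rho> builds in stability under locks: \<alpha> is an instance of the
  variable rule in \<open>Lock \<Gamma> \<rho>\<close>, and its conclusion must be derivable in
  \<open>Lock \<Gamma>' \<rho>\<close>.\<close>

definition substitution :: "'m pctx \<Rightarrow> 'm pctx \<Rightarrow> 'o \<Rightarrow> bool" where
  "substitution \<Gamma> \<Gamma>' m \<longleftrightarrow> ctx M \<Gamma> m \<and> ctx M \<Gamma>' m \<and>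
    (\<forall>\<mu> \<phi> \<nu> \<rho> k \<alpha>. (\<mu>, \<phi>, \<nu>) \<in> entries M \<Gamma> \<longrightarrow> modality M \<rho> k m \<longrightarrow>
      transformation M \<alpha> \<mu> (\<nu> \<odot> \<rho>) \<longrightarrow> derives M (Lock \<Gamma>' \<rho>) \<phi> k)"

lemma substitution_Ext:
  assumes s: "substitution \<Gamma> \<Gamma>' m" and \<mu>: "modality M \<mu> n m" and \<phi>: "wff M \<phi> n"
  shows "substitution (Ext \<Gamma> \<mu> \<phi>) (Ext \<Gamma>' \<mu> \<phi>) m"
  unfolding substitution_def
proof (intro conjI allI impI)
  show "ctx M (Ext \<Gamma> \<mu> \<phi>) m" and ctx': "ctx M (Ext \<Gamma>' \<mu> \<phi>) m"
    using assms by (auto simp: substitution_def intro: ctx_Ext)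
  fix \<kappa> \<psi> \<nu> \<rho> k \<alpha>
  assume e: "(\<kappa>, \<psi>, \<nu>) \<in> entries M (Ext \<Gamma> \<mu> \<phi>)" and \<rho>: "modality M \<rho> k m"
    and \<alpha>: "transformation M \<alpha> \<kappa> (\<nu> \<odot> \<rho>)"
  from e consider "(\<kappa>, \<psi>, \<nu>) = (\<mu>, \<phi>, mid M (mcod M \<mu>))" | "(\<kappa>, \<psi>, \<nu>) \<in> entries M \<Gamma>"
    by auto
  then show "derives M (Lock (Ext \<Gamma>' \<mu> \<phi>) \<rho>) \<psi> k"
  proof cases
    case 1
    then show ?thesis by (intro derives_Lock_entry[OF ctx' \<rho> _ \<alpha>]) simp
  next
    case 2
    then have d: "derives M (Lock \<Gamma>' \<rho>) \<psi> k" using s \<rho> \<alpha> unfolding substitution_def by blast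
    have "ctx M (Lock \<Gamma>' \<rho>) k" "ctx M (Lock (Ext \<Gamma>' \<mu> \<phi>) \<rho>) k"
      using s \<rho> ctx' by (auto simp: substitution_def intro: ctx_Lock)
    \<comment> \<open>Weakening under the lock: the target has just one additional entry, that of
      the new hypothesis.\<close>
    then show ?thesis
      by (intro derives_renaming[OF d] renaming_subset) force+
  qed
qed

lemma substitution_Lock:
  assumes s: "substitution \<Gamma> \<Gamma>' m" and \<mu>: "modality M \<mu> n m"
  shows "substitution (Lock \<Gamma> \<mu>) (Lock \<Gamma>' \<mu>) n"
  unfolding substitution_def
proof (intro conjI allI impI)
  show "ctx M (Lock \<Gamma> \<mu>) n" "ctx M (Lock \<Gamma>' \<mu>) n"
    using assms by (auto simp: substitution_def intro: ctx_Lock)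
  fix \<kappa> \<psi> \<nu> \<rho> k \<alpha>
  assume "(\<kappa>, \<psi>, \<nu>) \<in> entries M (Lock \<Gamma> \<mu>)" and \<rho>: "modality M \<rho> k n"
    and \<alpha>: "transformation M \<alpha> \<kappa> (\<nu> \<odot> \<rho>)"
  then obtain \<nu>\<^sub>0 where e: "(\<kappa>, \<psi>, \<nu>\<^sub>0) \<in> entries M \<Gamma>" and \<nu>: "\<nu> = \<nu>\<^sub>0 \<odot> \<mu>" by auto
  have ctx: "ctx M \<Gamma> m" "ctx M \<Gamma>' m" using s by (auto simp: substitution_def)
  \<comment> \<open>Associativity turns \<alpha> into an instance for the original substitution at
    the composite lock \<open>\<mu> \<odot> \<rho>\<close>; \<open>conv\<close> then splits that
    lock.\<close>
  have "\<nu> \<odot> \<rho> = \<nu>\<^sub>0 \<odot> (\<mu> \<odot> \<rho>)"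
    using mcomp_assoc[OF entries_modality[OF ctx(1) e] \<mu> \<rho>] \<nu> by simp
  then have "derives M (Lock \<Gamma>' (\<mu> \<odot> \<rho>)) \<psi> k"
    using s e \<alpha> mcomp_modality[OF \<mu> \<rho>] unfolding substitution_def by metis
  then show "derives M (Lock (Lock \<Gamma>' \<mu>) \<rho>) \<psi> k"
    using ctx_eq_sym[OF ctx_eq_lock_comp[OF ctx(2) \<mu> \<rho>]] by (rule conv)
qed

lemma derives_substitution:
  assumes "derives M \<Gamma> \<phi> m" and "substitution \<Gamma> \<Gamma>' m"
  shows "derives M \<Gamma>' \<phi> m"
  using assms
proof (rule derives_transport[where R = substitution])
  fix \<Gamma> \<Gamma>' \<mu> \<phi> \<nu> \<alpha> n
  assume s: "substitution \<Gamma> \<Gamma>' n" and e: "(\<mu>, \<phi>, \<nu>) \<in> entries M \<Gamma>"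
    and \<alpha>: "transformation M \<alpha> \<mu> \<nu>"
  have ctx: "ctx M \<Gamma> n" "ctx M \<Gamma>' n" using s by (auto simp: substitution_def)
  \<comment> \<open>The plain variable case is the instance where \<rho> is the identity;
    \<open>conv\<close> removes the identity lock.\<close>
  have "\<nu> \<odot> mid M n = \<nu>" using mcomp_mid_right[OF entries_modality[OF ctx(1) e]] .
  then have "derives M (Lock \<Gamma>' (mid M n)) \<phi> n"
    using s e \<alpha> mid_modality[OF ctx_mode[OF ctx(1)]] unfolding substitution_def by metis
  then show "derives M \<Gamma>' \<phi> n" using ctx_eq_lock_id[OF ctx(2)] by (rule conv)
next
  fix \<Gamma>\<^sub>0 \<Gamma> \<Gamma>' m
  assume "substitution \<Gamma> \<Gamma>' m" "ctx_eq M \<Gamma>\<^sub>0 \<Gamma> m"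
  then show "substitution \<Gamma>\<^sub>0 \<Gamma>' m"
    by (simp add: substitution_def ctx_eq_entries ctx_eq_well_formed)
qed (simp add: substitution_def, (rule substitution_Ext substitution_Lock; assumption)+)

section \<open>Cut as a substitution\<close>

lemma ctx_append_remove:
  "ctx M \<Gamma> (mcod M \<mu>) \<Longrightarrow> ctx M (Ext \<Gamma> \<mu> \<phi> \<frown> \<Delta>) b \<Longrightarrow> ctx M (\<Gamma> \<frown> \<Delta>) b"
  by (induction \<Delta> arbitrary: b)
    (auto elim!: ctx_ExtE ctx_LockE intro: ctx_Ext ctx_Lock simp: modality_cod)

lemma locks_modality:
  assumes "ctx M (Ext \<Gamma> \<mu> \<phi> \<frown> \<Delta>) b"
  shows "modality M (locks M (mcod M \<mu>) \<Delta>) b (mcod M \<mu>)"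
  using ctx_append_Ext[OF assms] by (auto elim!: ctx_ExtE simp: modality_cod)

text \<open>Each lock of \<Delta> composes on the right, and associativity gathers them into
  |\<Delta>|. This locates the hypotheses of \<Gamma> in the context left after the cut.\<close>

lemma entries_append_locks:
  assumes "ctx M \<Gamma> (mcod M \<mu>)" and "ctx M (Ext \<Gamma> \<mu> \<phi> \<frown> \<Delta>) b" and "(\<kappa>, \<psi>, \<nu>) \<in> entries M \<Gamma>"
  shows "(\<kappa>, \<psi>, \<nu> \<odot> locks M (mcod M \<mu>) \<Delta>) \<in> entries M (\<Gamma> \<frown> \<Delta>)"
  using assms(2)
proof (induction \<Delta> arbitrary: b)
  case Emp
  then show ?case
    using assms(3) mcomp_mid_right[OF entries_modality[OF assms(1,3)]] by simp
next
  case (Ext \<Delta> \<rho> \<chi>)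
  then show ?case by (auto elim!: ctx_ExtE)
next
  case (Lock \<Delta> \<rho>)
  from Lock.prems obtain c where c: "ctx M (Ext \<Gamma> \<mu> \<phi> \<frown> \<Delta>) c" and \<rho>: "modality M \<rho> b c"
    by (auto elim!: ctx_LockE)
  have "\<nu> \<odot> locks M (mcod M \<mu>) \<Delta> \<odot> \<rho> = \<nu> \<odot> (locks M (mcod M \<mu>) \<Delta> \<odot> \<rho>)"
    using mcomp_assoc[OF entries_modality[OF assms(1,3)] locks_modality[OF c] \<rho>] .
  then show ?case using Lock.IH[OF c] by force
qed

text \<open>Every entry other than that of the cut hypothesis survives and is answered by the
  variable rule; the cut hypothesis is answered by \<open>d\<close>, moved along a renaming.\<close>

lemma substitution_cut:
  assumes \<mu>: "modality M \<mu> n m" and \<Gamma>: "ctx M \<Gamma> m" and d: "derives M (Lock \<Gamma> \<mu>) \<phi> n"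
    and c: "ctx M (Ext \<Gamma> \<mu> \<phi> \<frown> \<Delta>) b"
  shows "substitution (Ext \<Gamma> \<mu> \<phi> \<frown> \<Delta>) (\<Gamma> \<frown> \<Delta>) b"
  unfolding substitution_def
proof (intro conjI allI impI)
  have m: "mcod M \<mu> = m" using \<mu> by (rule modality_cod)
  show "ctx M (Ext \<Gamma> \<mu> \<phi> \<frown> \<Delta>) b" by (rule c)
  show ctx': "ctx M (\<Gamma> \<frown> \<Delta>) b" using ctx_append_remove[OF _ c] \<Gamma> m by simp
  have \<Delta>: "modality M (locks M m \<Delta>) b m" using locks_modality[OF c] m by simp
  fix \<kappa> \<psi> \<nu> \<rho> k \<alpha>
  assume e: "(\<kappa>, \<psi>, \<nu>) \<in> entries M (Ext \<Gamma> \<mu> \<phi> \<frown> \<Delta>)" and \<rho>: "modality M \<rho> k b"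
    and \<alpha>: "transformation M \<alpha> \<kappa> (\<nu> \<odot> \<rho>)"
  from e consider "\<kappa> = \<mu>" "\<psi> = \<phi>" "\<nu> = locks M m \<Delta>" | "(\<kappa>, \<psi>, \<nu>) \<in> entries M (\<Gamma> \<frown> \<Delta>)"
    by (auto simp: entries_Ext_append m)
  then show "derives M (Lock (\<Gamma> \<frown> \<Delta>) \<rho>) \<psi> k"
  proof cases
    case 1
    then have \<alpha>': "transformation M \<alpha> \<mu> (locks M m \<Delta> \<odot> \<rho>)" using \<alpha> by simp
    \<comment> \<open>\<alpha> forces its source and target to have equal domains, so
      \<open>d\<close> lives at the required mode.\<close>
    have "n = k"
      using transformation_parallel[OF \<alpha>'] \<mu> mcomp_modality[OF \<Delta> \<rho>]
      by (auto dest: modality_unique)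
    have "renaming (Lock \<Gamma> \<mu>) (Lock (\<Gamma> \<frown> \<Delta>) \<rho>) n"
      unfolding renaming_def
    proof (intro conjI allI impI)
      show "ctx M (Lock \<Gamma> \<mu>) n" "ctx M (Lock (\<Gamma> \<frown> \<Delta>) \<rho>) n"
        using \<Gamma> \<mu> ctx' \<rho> \<open>n = k\<close> by (auto intro: ctx_Lock)
      fix \<kappa> \<chi> \<nu> assume "(\<kappa>, \<chi>, \<nu>) \<in> entries M (Lock \<Gamma> \<mu>)"
      then obtain \<nu>\<^sub>0 where e\<^sub>0: "(\<kappa>, \<chi>, \<nu>\<^sub>0) \<in> entries M \<Gamma>" and \<nu>: "\<nu> = \<nu>\<^sub>0 \<odot> \<mu>" by auto
      have \<nu>\<^sub>0: "modality M \<nu>\<^sub>0 m (mcod M \<kappa>)" using entries_modality[OF \<Gamma> e\<^sub>0] .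
      have "(\<kappa>, \<chi>, \<nu>\<^sub>0 \<odot> locks M m \<Delta> \<odot> \<rho>) \<in> entries M (Lock (\<Gamma> \<frown> \<Delta>) \<rho>)"
        using entries_append_locks[OF _ c e\<^sub>0] \<Gamma> m by force
      \<comment> \<open>Left whiskering by \<open>\<nu>\<^sub>0\<close> carries its composite with
        \<mu> to its composite with |\<Delta>| and \<rho>.\<close>
      moreover have "transformation M (tid M \<nu>\<^sub>0 \<star> \<alpha>) \<nu> (\<nu>\<^sub>0 \<odot> locks M m \<Delta> \<odot> \<rho>)"
        unfolding \<nu> mcomp_assoc[OF \<nu>\<^sub>0 \<Delta> \<rho>]
        by (rule hcomp_transformation[OF tid_transformation[OF \<nu>\<^sub>0] \<alpha>' \<nu>\<^sub>0 \<mu>])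
      ultimately show "\<exists>\<nu>' \<beta>. (\<kappa>, \<chi>, \<nu>') \<in> entries M (Lock (\<Gamma> \<frown> \<Delta>) \<rho>) \<and>
          transformation M \<beta> \<nu> \<nu>'"
        by blast
    qed
    then show ?thesis using derives_renaming[OF d] 1(2) \<open>n = k\<close> by blast
  next
    case 2
    then show ?thesis by (rule derives_Lock_entry[OF ctx' \<rho> _ \<alpha>])
  qed
qed

end

theorem theorem3:
  fixes M :: "('o, 'm, 't) two_category"
    and \<mu> :: 'm and n m b :: 'o
    and \<Gamma> \<Delta> :: "'m pctx" and \<phi> \<psi> :: "'m fm"
  assumes "mode_theory M"
    and "modality M \<mu> n m"
    and "ctx M \<Gamma> m"
    and "derives M (Lock \<Gamma> \<mu>) \<phi> n"
    and "derives M (Ext \<Gamma> \<mu> \<phi> \<frown> \<Delta>) \<psi> b"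
  shows "derives M (\<Gamma> \<frown> \<Delta>) \<psi> b"
proof -
  interpret mode_theory M by fact
  \<comment> \<open>Derivability entails the well-formedness that \<open>substitution_cut\<close>
    asks for.\<close>
  have "ctx M (Ext \<Gamma> \<mu> \<phi> \<frown> \<Delta>) b" using derives_well_formed assms(5) by blast
  then show ?thesis
    using derives_substitution[OF assms(5)] substitution_cut[OF assms(2-4)] by blast
qed

end
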